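(* $Q_9$ is the smallest hypercube that is not perfect injectively colorable; that is, for every integer $n$ with $1\le n\le 8$ the hypercube $Q_n$ is a perfect injectively colorable graph, while $Q_9$ is not a perfect injectively colorable graph.
   Context: For a vertex $x$ of a graph $G$, $N(x)$ is the set of vertices adjacent to $x$. A set $X\subseteq V(G)$ is an open packing of $G$ if $N(x)\cap N(y)=\emptyset$ for every pair of distinct $x,y\in X$ (two vertices of an open packing may be adjacent); $\rho^{\rm o}(G)$ is the maximum cardinality of an open packing of $G$, and a $\rho^{\rm o}$-set of $G$ is an open packing of $G$ of cardinality $\rho^{\rm o}(G)$. An injective coloring of $G$ is a partition of $V(G)$ into open packings (the color classes). A graph $G$ is perfect injectively colorable if it has an injective coloring in which every color class is a $\rho^{\rm o}$-set of $G$. $Q_n$ is the $n$-dimensional hypercube: its vertices are the binary strings of length $n$, and two are adjacent if they differ in exactly one coordinate. *)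

theory Defs
  imports "Graph_Theory.Pair_Digraph" "HOL-Library.Disjoint_Sets"
begin

text \<open>
  A finite simple graph is a \<^locale>\<open>pair_graph\<close>: an edge between \<open>x\<close> and \<open>y\<close> is represented
  by the two arcs \<open>(x, y)\<close> and \<open>(y, x)\<close>. The definitions below are meant for such graphs; in
  particular the maximum in \<open>open_packing_number\<close> needs finitely many vertices.
\<close>

definition neighborhood :: "'a pair_pre_digraph \<Rightarrow> 'a \<Rightarrow> 'a set" where
  "neighborhood G x = {y \<in> pverts G. (x, y) \<in> parcs G}"

definition open_packing :: "'a pair_pre_digraph \<Rightarrow> 'a set \<Rightarrow> bool" where
  "open_packing G X \<longleftrightarrow> X \<subseteq> pverts G \<and>
     (\<forall>x\<in>X. \<forall>y\<in>X. x \<noteq> y \<longrightarrow> neighborhood G x \<inter> neighborhood G y = {})"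

definition open_packing_number :: "'a pair_pre_digraph \<Rightarrow> nat" where
  "open_packing_number G = Max {card X | X. open_packing G X}"

definition max_open_packing :: "'a pair_pre_digraph \<Rightarrow> 'a set \<Rightarrow> bool" where
  "max_open_packing G X \<longleftrightarrow> open_packing G X \<and> card X = open_packing_number G"

definition injective_coloring :: "'a pair_pre_digraph \<Rightarrow> 'a set set \<Rightarrow> bool" where
  "injective_coloring G P \<longleftrightarrow> partition_on (pverts G) P \<and> (\<forall>X\<in>P. open_packing G X)"

definition perfect_injectively_colorable :: "'a pair_pre_digraph \<Rightarrow> bool" where
  "perfect_injectively_colorable G \<longleftrightarrow>
     (\<exists>P. injective_coloring G P \<and> (\<forall>X\<in>P. max_open_packing G X))"

definition hypercube :: "nat \<Rightarrow> bool list pair_pre_digraph" where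
  "hypercube n =
     \<lparr> pverts = {x. length x = n},
       parcs = {(x, y). length x = n \<and> length y = n \<and> (\<exists>!i. i < n \<and> x ! i \<noteq> y ! i)} \<rparr>"

lemma parcs_hypercube_iff:
  "(x, y) \<in> parcs (hypercube n) \<longleftrightarrow>
     length x = n \<and> length y = n \<and> (\<exists>!i. i < n \<and> x ! i \<noteq> y ! i)"
  by (simp add: hypercube_def)

lemma pair_graph_hypercube: "pair_graph (hypercube n)"
proof -
  have fin: "finite {x :: bool list. length x = n}"
    using finite_lists_length_eq[of "UNIV :: bool set" n] by simp
  have "parcs (hypercube n) \<subseteq> {x. length x = n} \<times> {x. length x = n}"
    by (auto simp: hypercube_def)
  then have fin_arcs: "finite (parcs (hypercube n))"
    by (rule finite_subset) (simp add: fin)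
  have arc_symm: "sym (parcs (hypercube n))"
  proof (rule symI)
    fix x y assume xy: "(x, y) \<in> parcs (hypercube n)"
    have "(\<lambda>i. i < n \<and> y ! i \<noteq> x ! i) = (\<lambda>i. i < n \<and> x ! i \<noteq> y ! i)"
      by (rule ext) (iprover dest: not_sym)
    then have "(\<exists>!i. i < n \<and> y ! i \<noteq> x ! i) \<longleftrightarrow> (\<exists>!i. i < n \<and> x ! i \<noteq> y ! i)"
      by (rule arg_cong)
    with xy show "(y, x) \<in> parcs (hypercube n)"
      unfolding parcs_hypercube_iff by iprover
  qed
  show ?thesis
  proof unfold_locales
    show "finite (pverts (hypercube n))"
      using fin by (simp add: hypercube_def)
    show "finite (parcs (hypercube n))"
      by (rule fin_arcs)
    show "symmetric (with_proj (hypercube n))"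
      using arc_symm by (simp only: symmetric_def with_proj_simps)
  next
    fix e assume "e \<in> parcs (hypercube n)"
    moreover obtain x y where e: "e = (x, y)"
      by (rule prod.exhaust)
    ultimately have xy: "length x = n" "length y = n" "\<exists>!i. i < n \<and> x ! i \<noteq> y ! i"
      unfolding e parcs_hypercube_iff by iprover+
    show "fst e \<in> pverts (hypercube n)" "snd e \<in> pverts (hypercube n)"
      using xy(1,2) by (simp_all add: e hypercube_def)
    obtain i where "x ! i \<noteq> y ! i"
      using xy(3) by (rule ex1E) iprover
    then have "x \<noteq> y"
      by (rule contrapos_nn) (rule arg_cong)
    then show "fst e \<noteq> snd e"
      by (simp add: e)
  qed
qed

lemma finite_open_packing_cards:
  assumes "finite (pverts G)"
  shows "finite {card X | X. open_packing G X}" "{card X | X. open_packing G X} \<noteq> {}"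
proof -
  have "{card X | X. open_packing G X} \<subseteq> card ` Pow (pverts G)"
    by (auto simp: open_packing_def)
  then show "finite {card X | X. open_packing G X}"
    by (rule finite_subset) (simp add: assms)
  have "open_packing G {}"
    by (simp add: open_packing_def)
  then show "{card X | X. open_packing G X} \<noteq> {}"
    by blast
qed

end

theory Submission
  imports Defs "HOL-Computational_Algebra.Primes"
begin

text \<open>
  An open packing of \<open>Q\<^sub>n\<close> is a set of words no two of which have Hamming distance 2.

  For \<open>n \<le> 2\<^sup>m\<close> colour a word by its syndrome, the XOR of the positions of its ones. Flipping the
  bits \<open>i \<noteq> j\<close> changes the syndrome by \<open>i XOR j \<noteq> 0\<close>, so the \<open>2\<^sup>m\<close> classes are open packings. If every
  open packing has at most \<open>2\<^sup>n\<^sup>-\<^sup>m\<close> elements, each class must attain this bound. For \<open>n \<le> 4\<close> the bound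
  holds because the neighborhoods of an open packing are disjoint \<open>n\<close>-sets. For \<open>n = 5\<close>, three
  words of equal parity in an open packing would have pairwise distances at least 4, but three
  words of length 5 have distances summing to at most 10. From there the bound at most doubles
  with each further dimension.

  For \<open>n = 9\<close> the same counting bound gives at most 56, while an explicit open packing has 36 elements,
  and no divisor of \<open>2\<^sup>9\<close> lies between 36 and 56.
\<close>

section \<open>Bit flips, Hamming distance and syndromes\<close>

definition flip :: "nat \<Rightarrow> bool list \<Rightarrow> bool list" where
  "flip i x = x[i := \<not> x ! i]"

fun hamming_dist :: "bool list \<Rightarrow> bool list \<Rightarrow> nat" where
  "hamming_dist (a # x) (b # y) = (if a = b then 0 else 1) + hamming_dist x y"
| "hamming_dist _ _ = 0"

text \<open>A Hamming parity check whose columns are the position numbers in binary. Column 0 is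
  allowed: excluding distance 2 only requires the columns to be pairwise distinct.\<close>

fun syndrome :: "nat \<Rightarrow> bool list \<Rightarrow> nat" where
  "syndrome k [] = 0"
| "syndrome k (b # x) = xor (if b then k else 0) (syndrome (Suc k) x)"

lemma length_flip [simp]: "length (flip i x) = length x"
  by (simp add: flip_def)

text \<open>For \<open>i\<close> beyond the end, \<open>flip i\<close> is the identity and hence
  still an involution.\<close>

lemma flip_flip: "flip i (flip i x) = x"
  by (cases "i < length x") (simp_all add: flip_def list_update_beyond)

lemma flip_Cons_0 [simp]: "flip 0 (b # x) = (\<not> b) # x"
  by (simp add: flip_def)

lemma flip_Cons_Suc [simp]: "flip (Suc i) (b # x) = b # flip i x"
  by (simp add: flip_def)

lemma flip_inj: "i < length x \<Longrightarrow> flip i x = flip j x \<Longrightarrow> i = j"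
  by (metis flip_def nth_list_update_eq nth_list_update_neq)

section \<open>Adjacency in the hypercube as flipping one bit\<close>

lemma pverts_hypercube: "pverts (hypercube n) = {x. length x = n}"
  by (simp add: hypercube_def)

lemma finite_pverts_hypercube: "finite (pverts (hypercube n))"
  using finite_lists_length_eq[of "UNIV :: bool set" n] by (simp add: pverts_hypercube)

lemma card_pverts_hypercube: "card (pverts (hypercube n)) = 2 ^ n"
  using card_lists_length_eq[of "UNIV :: bool set" n] by (simp add: pverts_hypercube)

lemma parcs_hypercube_flip:
  "(x, y) \<in> parcs (hypercube n) \<longleftrightarrow> length x = n \<and> (\<exists>i<n. y = flip i x)"
proof
  assume "(x, y) \<in> parcs (hypercube n)"
  then have len: "length x = n" "length y = n" and ex: "\<exists>!i. i < n \<and> x ! i \<noteq> y ! i"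
    by (simp_all add: parcs_hypercube_iff)
  from ex obtain i where i: "i < n" "x ! i \<noteq> y ! i"
    and uniq: "\<And>j. j < n \<Longrightarrow> x ! j \<noteq> y ! j \<Longrightarrow> j = i" by blast
  have "y = flip i x"
  proof (rule nth_equalityI)
    fix j assume "j < length y"
    then have j: "j < n" using len by simp
    show "y ! j = flip i x ! j"
    proof (cases "j = i")
      case True
      then show ?thesis using i len by (simp add: flip_def)
    next
      case False
      then have "x ! j = y ! j" using uniq j by blast
      then show ?thesis using False by (simp add: flip_def)
    qed
  qed (simp add: len)
  with len i show "length x = n \<and> (\<exists>i<n. y = flip i x)" by blast
next
  assume "length x = n \<and> (\<exists>i<n. y = flip i x)"
  then obtain i where "length x = n" "i < n" "y = flip i x" by blast
  then show "(x, y) \<in> parcs (hypercube n)"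
    by (auto simp: parcs_hypercube_iff flip_def nth_list_update split: if_splits intro!: ex1I[of _ i])
qed

lemma neighborhood_hypercube:
  "length x = n \<Longrightarrow> neighborhood (hypercube n) x = (\<lambda>i. flip i x) ` {..<n}"
  by (auto simp: neighborhood_def pverts_hypercube parcs_hypercube_flip)

lemma card_neighborhood_hypercube:
  assumes "length x = n"
  shows "card (neighborhood (hypercube n) x) = n"
proof -
  have "inj_on (\<lambda>i. flip i x) {..<n}"
    using assms by (intro inj_onI) (rule flip_inj, simp_all)
  then show ?thesis using assms by (simp add: neighborhood_hypercube card_image)
qed

section \<open>Hamming distance\<close>

lemma hamming_dist_eq_0_iff:
  "length x = length y \<Longrightarrow> hamming_dist x y = 0 \<longleftrightarrow> x = y"
  by (induction rule: list_induct2) auto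

lemma hamming_dist_flip: "i < length x \<Longrightarrow> hamming_dist (flip i x) x = 1"
proof (induction x arbitrary: i)
  case (Cons b x)
  then show ?case by (cases i) (auto simp: hamming_dist_eq_0_iff)
qed simp

lemma flip_if_hamming_dist_1:
  "length x = length y \<Longrightarrow> hamming_dist x y = 1 \<Longrightarrow> \<exists>i<length x. x = flip i y"
proof (induction rule: list_induct2)
  case (Cons a x b y)
  show ?case
  proof (cases "a = b")
    case True
    with Cons obtain i where "i < length x" "x = flip i y" by auto
    then show ?thesis using True by (intro exI[of _ "Suc i"]) simp
  next
    case False
    then show ?thesis using Cons by (intro exI[of _ 0]) (auto simp: hamming_dist_eq_0_iff)
  qed
qed simp

lemma flip_eq_flip_if_hamming_dist_2:
  "length x = length y \<Longrightarrow> hamming_dist x y = 2 \<Longrightarrow>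
     \<exists>i<length x. \<exists>j<length x. flip i x = flip j y"
proof (induction rule: list_induct2)
  case (Cons a x b y)
  show ?case
  proof (cases "a = b")
    case True
    with Cons obtain i j where "i < length x" "j < length x" "flip i x = flip j y" by auto
    then show ?thesis using True by (intro exI[of _ "Suc i"] conjI exI[of _ "Suc j"]) simp_all
  next
    case False
    with Cons obtain i where "i < length x" "x = flip i y"
      using flip_if_hamming_dist_1[of x y] by auto
    \<comment> \<open>The heads differ, so flipping the head of the first word and bit
      \<open>Suc i\<close> of the second leads to the same word.\<close>
    then show ?thesis
      using False by (intro exI[of _ 0] conjI exI[of _ "Suc i"]) simp_all
  qed
qed simp

lemma hamming_dist_triangle:
  "length x = length y \<Longrightarrow> length y = length z \<Longrightarrow>
     hamming_dist x z \<le> hamming_dist x y + hamming_dist y z"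
  by (induction rule: list_induct3) auto

text \<open>Among three bits at most two of the three pairs disagree, so each coordinate contributes
  at most 2.\<close>

lemma hamming_dist_perimeter:
  "length x = length y \<Longrightarrow> length y = length z \<Longrightarrow>
     hamming_dist x y + hamming_dist y z + hamming_dist x z \<le> 2 * length x"
  by (induction rule: list_induct3) auto

text \<open>Each disagreeing coordinate switches the parity of the number of ones; this is the
  bipartiteness of the hypercube.\<close>

lemma even_hamming_dist:
  "length x = length y \<Longrightarrow>
     even (hamming_dist x y) \<longleftrightarrow> (even (count_list x True) \<longleftrightarrow> even (count_list y True))"
  by (induction rule: list_induct2) auto

lemma hamming_dist_commute: "hamming_dist x y = hamming_dist y x"
  by (induction x y rule: hamming_dist.induct) auto

section \<open>Open packings as codes without distance 2\<close>

lemma disjoint_neighborhoods_hypercube_iff: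
  assumes "length x = n" "length y = n" "x \<noteq> y"
  shows "neighborhood (hypercube n) x \<inter> neighborhood (hypercube n) y = {} \<longleftrightarrow> hamming_dist x y \<noteq> 2"
proof
  assume disj: "neighborhood (hypercube n) x \<inter> neighborhood (hypercube n) y = {}"
  show "hamming_dist x y \<noteq> 2"
  proof
    assume "hamming_dist x y = 2"
    then obtain i j where "i < n" "j < n" "flip i x = flip j y"
      using flip_eq_flip_if_hamming_dist_2[of x y] assms by auto
    with disj show False using assms by (auto simp: neighborhood_hypercube disjoint_iff)
  qed
next
  assume ne: "hamming_dist x y \<noteq> 2"
  show "neighborhood (hypercube n) x \<inter> neighborhood (hypercube n) y = {}"
  proof (rule ccontr)
    assume "\<not> ?thesis"
    then obtain i j where ij: "i < n" "j < n" "flip i x = flip j y"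
      using assms by (auto simp: neighborhood_hypercube)
    define z where "z = flip i x"
    have len: "length z = n" using assms by (simp add: z_def)
    have z: "hamming_dist z x = 1" "hamming_dist z y = 1"
      using ij assms hamming_dist_flip[of i x] hamming_dist_flip[of j y] by (simp_all add: z_def)
    \<comment> \<open>Both words have the parity opposite to that of their common neighbor
      \<open>z\<close>. Being even, nonzero and at most 2, their distance is 2.\<close>
    have "even (hamming_dist x y)"
      using z even_hamming_dist[of z x] even_hamming_dist[of z y] even_hamming_dist[of x y] len assms
      by simp
    moreover have "hamming_dist x y \<le> 2"
      using hamming_dist_triangle[of x z y] z len assms hamming_dist_commute[of x z] by simp
    moreover have "hamming_dist x y \<noteq> 0"
      using assms by (simp add: hamming_dist_eq_0_iff)
    ultimately show False using ne by presburger
  qed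
qed

text \<open>The condition that the two words be distinct disappears because a word has distance 0
  from itself.\<close>

lemma open_packing_hypercube_iff:
  "open_packing (hypercube n) X \<longleftrightarrow>
     (\<forall>x\<in>X. length x = n) \<and> (\<forall>x\<in>X. \<forall>y\<in>X. hamming_dist x y \<noteq> 2)"
proof (cases "\<forall>x\<in>X. length x = n")
  case True
  have "(x \<noteq> y \<longrightarrow> neighborhood (hypercube n) x \<inter> neighborhood (hypercube n) y = {}) \<longleftrightarrow>
      hamming_dist x y \<noteq> 2" if "x \<in> X" "y \<in> X" for x y
    using True that disjoint_neighborhoods_hypercube_iff[of x n y] hamming_dist_eq_0_iff[of x y]
    by (cases "x = y") simp_all
  then have "(\<forall>x\<in>X. \<forall>y\<in>X. x \<noteq> y \<longrightarrow>
        neighborhood (hypercube n) x \<inter> neighborhood (hypercube n) y = {}) \<longleftrightarrow>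
      (\<forall>x\<in>X. \<forall>y\<in>X. hamming_dist x y \<noteq> 2)"
    by (intro ball_cong refl)
  then show ?thesis
    using True unfolding open_packing_def pverts_hypercube by blast
next
  case False
  then show ?thesis
    unfolding open_packing_def pverts_hypercube by blast
qed

lemma open_packing_hypercube_finite:
  "open_packing (hypercube n) X \<Longrightarrow> finite X"
  using finite_pverts_hypercube by (auto simp: open_packing_def intro: finite_subset)

section \<open>Upper bounds for open packings\<close>

lemma open_packing_hypercube_counting:
  assumes "open_packing (hypercube n) X"
  shows "n * card X \<le> 2 ^ n"
proof -
  let ?N = "neighborhood (hypercube n)"
  have len: "length x = n" if "x \<in> X" for x
    using assms that by (simp add: open_packing_hypercube_iff)
  have sub: "?N x \<subseteq> pverts (hypercube n)" for x
    by (auto simp: neighborhood_def)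
  have "card (\<Union>x\<in>X. ?N x) = (\<Sum>x\<in>X. card (?N x))"
  proof (rule card_UN_disjoint)
    show "finite X" using assms by (rule open_packing_hypercube_finite)
    show "\<forall>x\<in>X. finite (?N x)"
      using sub finite_pverts_hypercube finite_subset by blast
    show "\<forall>x\<in>X. \<forall>y\<in>X. x \<noteq> y \<longrightarrow> ?N x \<inter> ?N y = {}"
      using assms by (simp add: open_packing_def)
  qed
  also have "\<dots> = (\<Sum>x\<in>X. n)"
    using len by (intro sum.cong) (simp_all add: card_neighborhood_hypercube)
  finally have "card (\<Union>x\<in>X. ?N x) = n * card X" by simp
  moreover have "card (\<Union>x\<in>X. ?N x) \<le> card (pverts (hypercube n))"
    using sub by (intro card_mono finite_pverts_hypercube) blast
  ultimately show ?thesis by (simp add: card_pverts_hypercube)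
qed

text \<open>Counting neighborhoods would only give 6, so each of the two parity classes is bounded
  by 2 instead.\<close>

lemma open_packing_hypercube_5:
  assumes "open_packing (hypercube 5) X"
  shows "card X \<le> 4"
proof -
  have fin: "finite X" using assms by (rule open_packing_hypercube_finite)
  have parity_class: "card {x \<in> X. even (count_list x True) = p} \<le> 2" (is "card ?Y \<le> 2") for p
  proof (rule ccontr)
    assume "\<not> card ?Y \<le> 2"
    then obtain Z where "Z \<subseteq> ?Y" "card Z = 3"
      using obtain_subset_with_card_n[of 3 ?Y] by auto
    then obtain x y z where mem: "x \<in> ?Y" "y \<in> ?Y" "z \<in> ?Y" and ne: "x \<noteq> y" "y \<noteq> z" "x \<noteq> z"
      by (auto simp: card_3_iff)
    have dist: "4 \<le> hamming_dist u v" if "u \<in> ?Y" "v \<in> ?Y" "u \<noteq> v" for u v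
    proof -
      have len: "length u = length v" and "hamming_dist u v \<noteq> 2"
        using assms that by (auto simp: open_packing_hypercube_iff)
      moreover have "hamming_dist u v \<noteq> 0"
        using len that by (simp add: hamming_dist_eq_0_iff)
      moreover have "even (hamming_dist u v)"
        using len that by (simp add: even_hamming_dist)
      ultimately show ?thesis by presburger
    qed
    have "length x = 5" "length y = 5" "length z = 5"
      using assms mem by (auto simp: open_packing_hypercube_iff)
    then have "hamming_dist x y + hamming_dist y z + hamming_dist x z \<le> 10"
      using hamming_dist_perimeter[of x y z] by simp
    \<comment> \<open>Three distances of at least 4 sum to at least 12.\<close>
    with dist[OF mem(1,2) ne(1)] dist[OF mem(2,3) ne(2)] dist[OF mem(1,3) ne(3)]
    show False by linarith
  qed
  have "X = (\<Union>p. {x \<in> X. even (count_list x True) = p})" by blast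
  then have "card X \<le> (\<Sum>p\<in>UNIV. card {x \<in> X. even (count_list x True) = p})"
    using card_UN_le[of UNIV "\<lambda>p. {x \<in> X. even (count_list x True) = p}"] by simp
  also have "\<dots> \<le> (\<Sum>p\<in>(UNIV :: bool set). 2)"
    by (intro sum_mono parity_class)
  finally show ?thesis by simp
qed

text \<open>Split \<open>X\<close> by the first bit. Removing a common first bit preserves
  distances, so both halves are open packings one dimension lower.\<close>

lemma open_packing_hypercube_Suc:
  assumes bound: "\<And>Y. open_packing (hypercube n) Y \<Longrightarrow> card Y \<le> M"
    and X: "open_packing (hypercube (Suc n)) X"
  shows "card X \<le> 2 * M"
proof -
  define Y where "Y b = {x. b # x \<in> X}" for b
  have packing: "open_packing (hypercube n) (Y b)" for b
  proof -
    have "length x = n" if "x \<in> Y b" for x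
    proof -
      have "length (b # x) = Suc n"
        using X that unfolding open_packing_hypercube_iff Y_def by blast
      then show ?thesis by simp
    qed
    moreover have "hamming_dist x y \<noteq> 2" if "x \<in> Y b" "y \<in> Y b" for x y
    proof -
      have "hamming_dist (b # x) (b # y) \<noteq> 2"
        using X that unfolding open_packing_hypercube_iff Y_def by blast
      then show ?thesis by simp
    qed
    ultimately show ?thesis by (simp add: open_packing_hypercube_iff)
  qed
  have le: "card (Y b) \<le> M" and fin: "finite (Y b)" for b
    using packing by (rule bound, rule open_packing_hypercube_finite)
  have "X \<subseteq> Cons True ` Y True \<union> Cons False ` Y False"
  proof
    fix x assume "x \<in> X"
    moreover from this have "length x = Suc n"
      using X by (simp add: open_packing_hypercube_iff)
    then obtain b y where "x = b # y" by (auto simp: length_Suc_conv)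
    ultimately show "x \<in> Cons True ` Y True \<union> Cons False ` Y False"
      by (cases b) (simp_all add: Y_def)
  qed
  then have "card X \<le> card (Cons True ` Y True \<union> Cons False ` Y False)"
    using fin by (intro card_mono) auto
  also have "\<dots> \<le> card (Cons True ` Y True) + card (Cons False ` Y False)"
    by (rule card_Un_le)
  also have "\<dots> \<le> M + M"
    using le by (intro add_mono) (simp_all add: card_image)
  finally show ?thesis by simp
qed

lemma open_packing_hypercube_ge_5:
  "5 \<le> n \<Longrightarrow> open_packing (hypercube n) X \<Longrightarrow> card X \<le> 2 ^ (n - 3)"
proof (induction n arbitrary: X rule: nat_induct_at_least)
  case base
  then show ?case using open_packing_hypercube_5 by simp
next
  case (Suc n)
  have "card X \<le> 2 * 2 ^ (n - 3)"
    using Suc by (intro open_packing_hypercube_Suc) auto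
  also have "\<dots> = 2 ^ (Suc n - 3)"
  proof -
    have "Suc n - 3 = Suc (n - 3)" using Suc.hyps by linarith
    then show ?thesis by (simp only: power_Suc)
  qed
  finally show ?case .
qed

section \<open>The syndrome coloring\<close>

lemma syndrome_less:
  "k + length x \<le> 2 ^ m \<Longrightarrow> syndrome k x < 2 ^ m"
proof (induction x arbitrary: k)
  case (Cons b x)
  then have "syndrome (Suc k) x < 2 ^ m" "(if b then k else 0) < 2 ^ m"
    by auto
  \<comment> \<open>Numbers below \<open>2 ^ m\<close> are the fixed points of
    \<open>take_bit m\<close>, which commutes with \<open>xor\<close>.\<close>
  then show ?case
    by (simp only: syndrome.simps flip: take_bit_nat_eq_self_iff) (simp only: take_bit_xor)
qed simp

text \<open>Since \<open>xor\<close> is self-inverse, adding and removing the label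
  \<open>k + i\<close> are the same operation.\<close>

lemma syndrome_flip:
  "i < length x \<Longrightarrow> syndrome k (flip i x) = xor (k + i) (syndrome k x)"
proof (induction x arbitrary: i k)
  case (Cons b x)
  show ?case
  proof (cases i)
    case 0
    then show ?thesis by (simp flip: xor.assoc)
  next
    case (Suc j)
    then show ?thesis using Cons by (simp add: xor.left_commute)
  qed
qed simp

lemma open_packing_syndrome_class:
  "open_packing (hypercube n) {x. length x = n \<and> syndrome 0 x = j}"
proof -
  have "x = y" if "length x = n" "length y = n" "syndrome 0 x = syndrome 0 y"
      "i < n" "i' < n" "flip i x = flip i' y" for x y i i'
  proof -
    let ?z = "flip i x"
    have "syndrome 0 x = xor i (syndrome 0 ?z)"
      using that(1,4) syndrome_flip[of i "flip i x" 0] by (simp add: flip_flip)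
    moreover have "syndrome 0 y = xor i' (syndrome 0 ?z)"
      using that syndrome_flip[of i' "flip i' y" 0] by (simp add: flip_flip)
    ultimately have "xor i (syndrome 0 ?z) = xor i' (syndrome 0 ?z)"
      using that by metis
    \<comment> \<open>Cancelling the syndrome of the common neighbor leaves equal flip positions;
      undoing the flip gives \<open>x = y\<close>.\<close>
    then have "xor (xor i (syndrome 0 ?z)) (syndrome 0 ?z) = xor (xor i' (syndrome 0 ?z)) (syndrome 0 ?z)"
      by simp
    then have "i = i'" by (simp add: xor.assoc)
    with that show ?thesis by (metis flip_flip)
  qed
  then show ?thesis
    by (auto simp: open_packing_def pverts_hypercube neighborhood_hypercube)
qed

section \<open>From a coloring and a matching bound to perfection\<close>

lemma open_packing_number_eqI:
  assumes fin: "finite (pverts G)" and X: "open_packing G X"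
    and bound: "\<And>Y. open_packing G Y \<Longrightarrow> card Y \<le> card X"
  shows "open_packing_number G = card X"
  unfolding open_packing_number_def
  using finite_open_packing_cards(1)[OF fin] X bound by (intro Max_eqI) auto

text \<open>The \<open>k\<close> classes have at most \<open>M\<close> elements each but cover
  \<open>k * M\<close> vertices, so none falls short. A class then witnesses that \<open>M\<close>
  is the open packing number.\<close>

lemma perfect_injectively_colorableI:
  fixes c :: "'a \<Rightarrow> nat"
  assumes fin: "finite (pverts G)"
    and c: "\<And>x. x \<in> pverts G \<Longrightarrow> c x < k"
    and packing: "\<And>j. open_packing G {x \<in> pverts G. c x = j}"
    and bound: "\<And>X. open_packing G X \<Longrightarrow> card X \<le> M"
    and card: "card (pverts G) = k * M" and "0 < M"
  shows "perfect_injectively_colorable G"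
proof -
  define C where "C j = {x \<in> pverts G. c x = j}" for j
  have "pverts G = (\<Union>j<k. C j)" using c by (auto simp: C_def)
  moreover have "card (\<Union>j<k. C j) = (\<Sum>j<k. card (C j))"
    using fin by (intro card_UN_disjoint) (auto simp: C_def)
  ultimately have "k * M = (\<Sum>j<k. card (C j))"
    using card by metis
  moreover have le: "card (C j) \<le> M" for j
    using packing bound by (simp add: C_def)
  ultimately have eq: "card (C j) = M" if "j < k" for j
    using sum_mono_inv[of "\<lambda>j. card (C j)" "{..<k}" "\<lambda>_. M" j] that by simp
  have max: "max_open_packing G (C j)" if "j < k" for j
    using eq[OF that] packing bound open_packing_number_eqI[OF fin, of "C j"]
    by (auto simp: max_open_packing_def C_def)
  have "partition_on (pverts G) (C ` {..<k})"
  proof (rule partition_onI)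
    show "\<Union> (C ` {..<k}) = pverts G" using c by (auto simp: C_def)
    show "disjnt p q" if "p \<in> C ` {..<k}" "q \<in> C ` {..<k}" "p \<noteq> q" for p q
      using that by (auto simp: C_def disjnt_def)
    \<comment> \<open>Every color below \<open>k\<close> is used, because its class has
      \<open>M > 0\<close> elements.\<close>
    show "{} \<notin> C ` {..<k}"
      using eq \<open>0 < M\<close> by (metis card.empty imageE less_irrefl lessThan_iff)
  qed
  then show ?thesis
    using max packing
    by (auto simp: perfect_injectively_colorable_def injective_coloring_def C_def
        intro!: exI[of _ "C ` {..<k}"])
qed

lemma perfect_hypercubeI:
  assumes "n \<le> 2 ^ m" "m \<le> n"
    and bound: "\<And>X. open_packing (hypercube n) X \<Longrightarrow> card X \<le> 2 ^ (n - m)"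
  shows "perfect_injectively_colorable (hypercube n)"
proof (rule perfect_injectively_colorableI)
  show "syndrome 0 x < 2 ^ m" if "x \<in> pverts (hypercube n)" for x
    using that assms by (intro syndrome_less) (simp add: pverts_hypercube)
  show "open_packing (hypercube n) {x \<in> pverts (hypercube n). syndrome 0 x = j}" for j
    using open_packing_syndrome_class[of n j] by (simp add: pverts_hypercube)
  show "card (pverts (hypercube n)) = 2 ^ m * 2 ^ (n - m)"
    using \<open>m \<le> n\<close> by (simp add: card_pverts_hypercube flip: power_add)
qed (use bound finite_pverts_hypercube in auto)

lemma perfect_hypercube_le_8:
  assumes "1 \<le> n" "n \<le> 8"
  shows "perfect_injectively_colorable (hypercube n)"
proof (cases "n \<le> 4")
  case True
  \<comment> \<open>With 0, 1, 2, 2 syndrome bits the classes must have 2, 2, 2, 4 elements, and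
    these are exactly the counting bounds \<open>2 ^ n div n\<close>.\<close>
  with assms consider "n = 1" | "n = 2" | "n = 3" | "n = 4" by linarith
  then show ?thesis
  proof cases
    case 1
    then show ?thesis
      using open_packing_hypercube_counting[of n] by (intro perfect_hypercubeI[of n 0]) auto
  next
    case 2
    then show ?thesis
      using open_packing_hypercube_counting[of n] by (intro perfect_hypercubeI[of n 1]) force+
  next
    case 3
    then show ?thesis
      using open_packing_hypercube_counting[of n] by (intro perfect_hypercubeI[of n 2]) force+
  next
    case 4
    then show ?thesis
      using open_packing_hypercube_counting[of n] by (intro perfect_hypercubeI[of n 2]) force+
  qed
next
  case False
  then show ?thesis
    using assms open_packing_hypercube_ge_5[of n] by (intro perfect_hypercubeI[of n 3]) auto
qed

section \<open>Dimension 9\<close>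

text \<open>
  The two generators, found by computer search, have even weight, and so do their rotations. The
  complements have odd weight because 9 is odd.
\<close>

definition cyclic_packing_9 :: "bool list list" where
  "cyclic_packing_9 =
     (let W = concat (map (\<lambda>w. map (\<lambda>i. rotate i w) [0..<9])
        [[False, False, False, False, True, False, True, True, True],
         [False, False, True, True, True, True, False, True, True]])
      in W @ map (map Not) W)"

text \<open>Words from different halves have opposite parity, hence odd distance, and complementing
  preserves distances. Mathematically only the 18 even words are at stake; the evaluation checks all
  pairs.\<close>

lemma cyclic_packing_9:
  "length cyclic_packing_9 = 36 \<and> distinct cyclic_packing_9 \<and>
   list_all (\<lambda>x. length x = 9 \<and> list_all (\<lambda>y. hamming_dist x y \<noteq> 2) cyclic_packing_9) cyclic_packing_9"
  by code_simp

lemma open_packing_number_hypercube_9_bounds: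
  "36 \<le> open_packing_number (hypercube 9)" "open_packing_number (hypercube 9) \<le> 56"
proof -
  let ?S = "{card X | X. open_packing (hypercube 9) X}"
  note S = finite_open_packing_cards[OF finite_pverts_hypercube[of 9]]
  have "open_packing (hypercube 9) (set cyclic_packing_9)"
    using cyclic_packing_9 by (simp add: open_packing_hypercube_iff list_all_iff)
  moreover have "card (set cyclic_packing_9) = 36"
    using cyclic_packing_9 by (simp add: distinct_card)
  ultimately have "36 \<in> ?S" by (metis (mono_tags, lifting) mem_Collect_eq)
  then show "36 \<le> open_packing_number (hypercube 9)"
    unfolding open_packing_number_def using S(1) by (rule Max_ge[rotated])
  have "open_packing_number (hypercube 9) \<in> ?S"
    unfolding open_packing_number_def by (rule Max_in[OF S])
  \<comment> \<open>Here \<open>9 * 57 = 513\<close> exceeds \<open>2 ^ 9 = 512\<close>.\<close>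
  then show "open_packing_number (hypercube 9) \<le> 56"
    using open_packing_hypercube_counting[of 9] by force
qed

text \<open>The color classes of a perfect coloring all have the same size.\<close>

lemma perfect_imp_open_packing_number_dvd:
  assumes fin: "finite (pverts G)" and "perfect_injectively_colorable G"
  shows "open_packing_number G dvd card (pverts G)"
proof -
  obtain P where part: "partition_on (pverts G) P" and max: "\<forall>X\<in>P. max_open_packing G X"
    using assms by (auto simp: perfect_injectively_colorable_def injective_coloring_def)
  have "open_packing_number G * card P = card (\<Union>P)"
  proof (rule card_partition)
    show "finite P" using part fin by (rule finite_elements[rotated])
    show "finite (\<Union>P)" using part fin by (simp add: partition_on_def)
    show "card X = open_packing_number G" if "X \<in> P" for X
      using max that by (simp add: max_open_packing_def)
    show "X \<inter> Y = {}" if "X \<in> P" "Y \<in> P" "X \<noteq> Y" for X Y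
      using part that by (auto simp: partition_on_def disjoint_def)
  qed
  then show ?thesis using part by (metis dvd_triv_left partition_on_def)
qed

lemma not_perfect_hypercube_9: "\<not> perfect_injectively_colorable (hypercube 9)"
proof
  let ?r = "open_packing_number (hypercube 9)"
  assume "perfect_injectively_colorable (hypercube 9)"
  then have "?r dvd 2 ^ 9"
    using perfect_imp_open_packing_number_dvd[OF finite_pverts_hypercube] card_pverts_hypercube
    by metis
  then obtain k where k: "?r = 2 ^ k"
    using divides_primepow_nat[of 2 ?r 9] two_is_prime_nat by blast
  \<comment> \<open>The bounds 36 and 56 lie strictly between the consecutive powers 32 and
    64.\<close>
  have "(2::nat) ^ 5 < 2 ^ k" "(2::nat) ^ k < 2 ^ 6"
    using open_packing_number_hypercube_9_bounds k by simp_all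
  then have "5 < k \<and> k < 6" by (metis one_less_numeral_iff power_less_imp_less_exp semiring_norm(76))
  then show False by linarith
qed

theorem mainTheorem3:
  shows "(\<forall>n::nat. 1 \<le> n \<and> n \<le> 8 \<longrightarrow> perfect_injectively_colorable (hypercube n)) \<and>
         \<not> perfect_injectively_colorable (hypercube 9)"
  using perfect_hypercube_le_8 not_perfect_hypercube_9 by blast

end
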